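(* Let $\alpha>0$ and $k^t,k^d\in\mathbb{N}$ be such that $\alpha\left\lceil\frac{k^d}{k^t}\right\rceil<1$. There is an instance $I$ of the relief distribution problem with $k^t$ trucks, $k^d$ drones and drone speed $\alpha$ such that $$\frac{\mathrm{Optimistic}(I)}{\mathrm{OPT}(I^* )}=1+\left\lceil\frac{k^d}{k^t}\right\rceil\alpha.$$
   Context: Relief distribution problem (RDP). $\mathbb{N}=\{1,2,\dots\}$. An instance is $I=(k^t,k^d,\alpha,G,D)$: $k^t,k^d\in\mathbb{N}$ are the numbers of trucks and drones; $\alpha>0$ is the drone speed; $G=(V,E,c)$ is a finite connected undirected graph (not necessarily complete) with $V=\{v_0\}\cup C$, where $v_0$ is the depot and $C\neq\emptyset$ is the set of non-depot nodes; edge lengths $c(i,j)>0$ satisfy the triangle inequality; $D\subseteq C$ is the set of damaged nodes, initially unknown; the status of a node is revealed when some vehicle first arrives at it. For non-adjacent $i,j$, $c(i,j)$ is the shortest-path distance. A truck needs time $c(i,j)$ to traverse an edge, a drone needs $\frac1\alpha c(i,j)$. A tour is a closed walk in $G$ starting and ending at $v_0$ (possibly of length $0$); it visits all nodes lying on it. The makespan of a family of tours is the maximum duration of a tour. Full-information optimum: $\mathrm{OPT}(I^* )$ is the minimum makespan over all families of $k^t$ truck tours and $k^d$ drone tours such that every node of $C$ is visited by some vehicle and every node of $D$ is visited by a truck ($I^*$ is the instance $I$ with $D$ known in advance). For integers $m,n\ge 0$ with $m+n\ge1$ and $W\subseteq C$, $\mathrm{TSP}_{m,n}(W)$ denotes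 the minimum makespan over all families of $m$ truck tours and $n$ drone tours that together visit all nodes of $W$, and $S^*_{m,n}(W)$ denotes an optimal such family. Policy Optimistic (deterministic; optimal families are selected by a fixed rule based only on the information available at that time, so the first-stage tours do not depend on $D$). First stage: the vehicles execute the tours of $S^*_{k^t,k^d}(C)$ and return to the depot. Let $D^d\subseteq D$ be the set of damaged nodes not visited by truck tours in this stage. Second stage (after all vehicles returned): the trucks execute $S^*_{k^t,0}(D^d)$. Its makespan is $\mathrm{Optimistic}(I)=\mathrm{TSP}_{k^t,k^d}(C)+\mathrm{TSP}_{k^t,0}(D^d)$. *)

theory Defs
  imports "Graph_Theory.Graph_Theory"
begin

section \<open>Instances\<close>

text \<open>
  The part of an instance that is known in advance is kept in a record of its own:
  a deterministic rule for choosing tours may depend on it, but not on the damaged nodes.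
  An undirected simple graph is a \<^locale>\<open>pair_graph\<close> (finite, symmetric, loop-free).
\<close>

record 'v network =
  trucks :: nat
  drones :: nat
  speed :: real
  roads :: "'v pair_pre_digraph"
  depot :: 'v
  len :: "'v \<times> 'v \<Rightarrow> real"

record 'v rdp =
  net :: "'v network"
  damaged :: "'v set"

definition customers :: "'v network \<Rightarrow> 'v set" where
  "customers K = pverts (roads K) - {depot K}"

definition is_network :: "'v network \<Rightarrow> bool" where
  "is_network K \<longleftrightarrow>
     trucks K \<ge> 1 \<and> drones K \<ge> 1 \<and> speed K > 0 \<and>
     pair_graph (roads K) \<and> Digraph_Component.connected (with_proj (roads K)) \<and>
     depot K \<in> pverts (roads K) \<and> customers K \<noteq> {} \<and>
     (\<forall>e \<in> parcs (roads K). len K e > 0) \<and>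
     (\<forall>u \<in> pverts (roads K). \<forall>v \<in> pverts (roads K). len K (u, v) = len K (v, u)) \<and>
     (\<forall>u \<in> pverts (roads K). \<forall>v \<in> pverts (roads K). (u, v) \<notin> parcs (roads K) \<longrightarrow>
        ereal (len K (u, v)) = wf_digraph.\<mu> (with_proj (roads K)) (len K) u v) \<and>
     (\<forall>u \<in> pverts (roads K). \<forall>v \<in> pverts (roads K). \<forall>w \<in> pverts (roads K).
        len K (u, w) \<le> len K (u, v) + len K (v, w))"

definition is_rdp :: "'v rdp \<Rightarrow> bool" where
  "is_rdp I \<longleftrightarrow> is_network (net I) \<and> damaged I \<subseteq> customers (net I)"


section \<open>Tours\<close>

text \<open>A family consists of the list of truck tours and the list of drone tours.\<close>

type_synonym 'v tour = "('v \<times> 'v) awalk"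
type_synonym 'v family = "'v tour list \<times> 'v tour list"

definition is_tour :: "'v network \<Rightarrow> 'v tour \<Rightarrow> bool" where
  "is_tour K p \<longleftrightarrow> pre_digraph.awalk (with_proj (roads K)) (depot K) p (depot K)"

definition visited :: "'v network \<Rightarrow> 'v tour list \<Rightarrow> 'v set" where
  "visited K ps = (\<Union>p \<in> set ps. set (pre_digraph.awalk_verts (with_proj (roads K)) (depot K) p))"

definition truck_time :: "'v network \<Rightarrow> 'v tour \<Rightarrow> real" where
  "truck_time K p = wf_digraph.awalk_cost (len K) p"

definition drone_time :: "'v network \<Rightarrow> 'v tour \<Rightarrow> real" where
  "drone_time K p = wf_digraph.awalk_cost (\<lambda>e. 1 / speed K * len K e) p"

definition makespan :: "'v network \<Rightarrow> 'v family \<Rightarrow> real" where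
  "makespan K F = Max (truck_time K ` set (fst F) \<union> drone_time K ` set (snd F))"

definition families :: "'v network \<Rightarrow> nat \<Rightarrow> nat \<Rightarrow> 'v family set" where
  "families K m n = {(ts, ds). length ts = m \<and> length ds = n \<and>
     (\<forall>p \<in> set ts \<union> set ds. is_tour K p)}"

definition covering :: "'v network \<Rightarrow> nat \<Rightarrow> nat \<Rightarrow> 'v set \<Rightarrow> 'v family set" where
  "covering K m n W = {F \<in> families K m n. W \<subseteq> visited K (fst F @ snd F)}"


section \<open>Optimal values\<close>

text \<open>The minima below are attained, see \<open>min_makespan_attained\<close>.\<close>

definition min_makespan :: "'v network \<Rightarrow> 'v family set \<Rightarrow> real" where
  "min_makespan K \<F> = (LEAST t. t \<in> makespan K ` \<F>)"

definition TSP :: "'v network \<Rightarrow> nat \<Rightarrow> nat \<Rightarrow> 'v set \<Rightarrow> real" where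
  "TSP K m n W = min_makespan K (covering K m n W)"

definition OPT :: "'v rdp \<Rightarrow> real" where
  "OPT I = min_makespan (net I)
     {F \<in> covering (net I) (trucks (net I)) (drones (net I)) (customers (net I)).
        damaged I \<subseteq> visited (net I) (fst F)}"


section \<open>The policy Optimistic\<close>

type_synonym 'v rule = "'v network \<Rightarrow> nat \<Rightarrow> nat \<Rightarrow> 'v set \<Rightarrow> 'v family"

text \<open>
  \<open>S K m n W\<close> is the optimal family of \<open>m\<close> truck tours and \<open>n\<close> drone tours
  visiting \<open>W\<close> that the policy executes. Several families may be optimal,
  and the damaged nodes left for the second stage depend on which one is chosen.
\<close>

definition selection_rule :: "'v rule \<Rightarrow> bool" where
  "selection_rule S \<longleftrightarrow> (\<forall>K m n W. is_network K \<and> m + n \<ge> 1 \<and> W \<subseteq> customers K \<longrightarrow>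
     is_arg_min (makespan K) (\<lambda>F. F \<in> covering K m n W) (S K m n W))"

definition first_stage :: "'v rule \<Rightarrow> 'v rdp \<Rightarrow> 'v family" where
  "first_stage S I = S (net I) (trucks (net I)) (drones (net I)) (customers (net I))"

definition undelivered :: "'v rule \<Rightarrow> 'v rdp \<Rightarrow> 'v set" where
  "undelivered S I = damaged I - visited (net I) (fst (first_stage S I))"

definition second_stage :: "'v rule \<Rightarrow> 'v rdp \<Rightarrow> 'v family" where
  "second_stage S I = S (net I) (trucks (net I)) 0 (undelivered S I)"

definition Optimistic :: "'v rule \<Rightarrow> 'v rdp \<Rightarrow> real" where
  "Optimistic S I = makespan (net I) (first_stage S I) + makespan (net I) (second_stage S I)"


section \<open>Minima are attained\<close>

lemma is_networkD:
  assumes "is_network K"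
  shows "pair_graph (roads K)" "wf_digraph (with_proj (roads K))"
    and "finite (parcs (roads K))" "depot K \<in> pverts (roads K)" "speed K > 0"
    and "\<And>e. e \<in> parcs (roads K) \<Longrightarrow> len K e > 0"
proof -
  show g: "pair_graph (roads K)" and "depot K \<in> pverts (roads K)" "speed K > 0"
    and "\<And>e. e \<in> parcs (roads K) \<Longrightarrow> len K e > 0"
    using assms unfolding is_network_def by auto
  interpret pair_graph "roads K" by (rule g)
  show "wf_digraph (with_proj (roads K))" by unfold_locales
  show "finite (parcs (roads K))" by (rule pair_finite_arcs)
qed

lemma is_tour_arcs:
  "is_tour K p \<Longrightarrow> set p \<subseteq> parcs (roads K)"
  by (simp add: is_tour_def pre_digraph.awalk_def)

lemma truck_time_sum:
  assumes "is_network K"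
  shows "truck_time K p = sum_list (map (len K) p)"
  unfolding truck_time_def using wf_digraph.awalk_cost_def[OF is_networkD(2)[OF assms]] .

lemma drone_time_eq:
  assumes "is_network K"
  shows "drone_time K p = truck_time K p / speed K"
  unfolding drone_time_def truck_time_def
    wf_digraph.awalk_cost_def[OF is_networkD(2)[OF assms]]
  by (induction p) (simp_all add: field_simps add_divide_distrib)

lemma finite_tours_bounded:
  assumes K: "is_network K"
  shows "finite {p. is_tour K p \<and> truck_time K p \<le> B}"
proof (cases "parcs (roads K) = {}")
  case True
  have "{p. is_tour K p \<and> truck_time K p \<le> B} \<subseteq> {[]}"
    using is_tour_arcs True by fastforce
  then show ?thesis by (rule finite_subset) simp
next
  case False
  let ?A = "parcs (roads K)"
  define \<epsilon> where "\<epsilon> = Min (len K ` ?A)"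
  have fin: "finite ?A" by (rule is_networkD(3)[OF K])
  have pos: "\<epsilon> > 0" unfolding \<epsilon>_def using fin False is_networkD(6)[OF K] by (subst Min_gr_iff) auto
  have le: "\<epsilon> \<le> len K e" if "e \<in> ?A" for e unfolding \<epsilon>_def using fin that by simp
  have long: "\<epsilon> * length p \<le> truck_time K p" if "set p \<subseteq> ?A" for p
    using that
  proof (induction p)
    case (Cons e p)
    then show ?case using le[of e] by (simp add: truck_time_sum[OF K] algebra_simps)
  qed (simp add: truck_time_sum[OF K])
  have "{p. is_tour K p \<and> truck_time K p \<le> B} \<subseteq> {p. set p \<subseteq> ?A \<and> length p \<le> nat \<lceil>B / \<epsilon>\<rceil>}"
  proof safe
    fix p assume p: "is_tour K p" "truck_time K p \<le> B"
    have "\<epsilon> * length p \<le> B" using long[OF is_tour_arcs[OF p(1)]] p(2) by simp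
    then have "length p \<le> B / \<epsilon>" using pos by (simp add: field_simps)
    then show "length p \<le> nat \<lceil>B / \<epsilon>\<rceil>" by linarith
  qed (use is_tour_arcs in blast)
  then show ?thesis using finite_lists_length_le[OF fin] by (rule finite_subset)
qed

lemma makespan_le_iff:
  assumes "F \<in> families K m n" "m + n \<ge> 1"
  shows "makespan K F \<le> B \<longleftrightarrow>
    (\<forall>p \<in> set (fst F). truck_time K p \<le> B) \<and> (\<forall>p \<in> set (snd F). drone_time K p \<le> B)"
proof -
  have "truck_time K ` set (fst F) \<union> drone_time K ` set (snd F) \<noteq> {}"
    using assms by (auto simp: families_def)
  then show ?thesis by (auto simp: makespan_def)
qed

lemma min_makespan_attained:
  assumes K: "is_network K" and "m + n \<ge> 1" and sub: "\<F> \<subseteq> families K m n" and "\<F> \<noteq> {}"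
  shows "\<exists>F. is_arg_min (makespan K) (\<lambda>F. F \<in> \<F>) F"
proof -
  obtain F0 where F0: "F0 \<in> \<F>" using \<open>\<F> \<noteq> {}\<close> by blast
  define B where "B = makespan K F0"
  define P where "P = {p. is_tour K p \<and> truck_time K p \<le> B} \<union>
    {p. is_tour K p \<and> truck_time K p \<le> B * speed K}"
  define \<G> where "\<G> = {F \<in> \<F>. makespan K F \<le> B}"
  have "finite P" unfolding P_def using finite_tours_bounded[OF K] by blast
  have "\<G> \<subseteq> {ts. set ts \<subseteq> P \<and> length ts = m} \<times> {ds. set ds \<subseteq> P \<and> length ds = n}"
  proof
    fix F assume F: "F \<in> \<G>"
    then have fam: "F \<in> families K m n" using sub by (auto simp: \<G>_def)
    have "\<forall>p \<in> set (fst F). truck_time K p \<le> B" "\<forall>p \<in> set (snd F). drone_time K p \<le> B"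
      using F makespan_le_iff[OF fam \<open>m + n \<ge> 1\<close>] by (auto simp: \<G>_def)
    then show "F \<in> {ts. set ts \<subseteq> P \<and> length ts = m} \<times> {ds. set ds \<subseteq> P \<and> length ds = n}"
      using fam is_networkD(5)[OF K]
      by (auto simp: families_def P_def drone_time_eq[OF K] field_simps)
  qed
  then have fin: "finite \<G>"
    by (rule finite_subset) (intro finite_cartesian_product finite_lists_length_eq \<open>finite P\<close>)
  have "F0 \<in> \<G>" using F0 by (simp add: \<G>_def B_def)
  then have ne: "\<G> \<noteq> {}" by blast
  obtain F where F: "F \<in> \<G>" "\<And>F'. F' \<in> \<G> \<Longrightarrow> makespan K F \<le> makespan K F'"
    using ex_min_if_finite[OF finite_imageI[OF fin, of "makespan K"]] ne
    by (metis (no_types, lifting) imageE image_eqI image_is_empty linorder_not_le)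
  have "makespan K F \<le> makespan K F'" if "F' \<in> \<F>" for F'
    using F that by (cases "F' \<in> \<G>") (auto simp: \<G>_def)
  then have "is_arg_min (makespan K) (\<lambda>F. F \<in> \<F>) F"
    using F(1) unfolding is_arg_min_linorder \<G>_def by blast
  then show ?thesis ..
qed

lemma min_makespan_eq:
  assumes "is_arg_min (makespan K) (\<lambda>F. F \<in> \<F>) F"
  shows "min_makespan K \<F> = makespan K F"
  unfolding min_makespan_def
  using assms by (intro Least_equality) (auto simp: is_arg_min_linorder)

lemma (in wf_digraph) closed_walk_through:
  assumes sc: "strongly_connected G" and "u \<in> verts G" and "finite W" "W \<subseteq> verts G"
  shows "\<exists>p. awalk u p u \<and> W \<subseteq> set (awalk_verts u p)"
  using assms(3,4)
proof (induction W rule: finite_induct)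
  case empty
  then show ?case using awalk_Nil_iff[of u u] \<open>u \<in> verts G\<close> by blast
next
  case (insert w W)
  obtain p where p: "awalk u p u" "W \<subseteq> set (awalk_verts u p)"
    using insert by auto
  have "u \<rightarrow>\<^sup>* w" "w \<rightarrow>\<^sup>* u"
    using sc insert.prems \<open>u \<in> verts G\<close> by (auto simp: strongly_connected_def)
  then obtain q r where q: "awalk u q w" and r: "awalk w r u"
    unfolding reachable_awalk by blast
  have rp: "awalk w (r @ p) u" using r p(1) by (rule awalk_appendI)
  have "w \<in> set (awalk_verts w (r @ p))" using rp by (rule hd_in_awalk_verts)
  then have "insert w W \<subseteq> set (awalk_verts u (q @ r @ p))"
    unfolding set_awalk_verts_append[OF q rp] using p(2) set_awalk_verts_append[OF r p(1)] by blast
  moreover have "awalk u (q @ r @ p) u" using q rp by (rule awalk_appendI)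
  ultimately show ?case by blast
qed

lemma ex_covering:
  assumes K: "is_network K" and "m + n \<ge> 1" and W: "W \<subseteq> customers K"
  shows "\<exists>F \<in> covering K m n W. m \<ge> 1 \<longrightarrow> W \<subseteq> visited K (fst F)"
proof -
  interpret D: wf_digraph "with_proj (roads K)" by (rule is_networkD(2)[OF K])
  interpret P: pair_graph "roads K" by (rule is_networkD(1)[OF K])
  have "symmetric (with_proj (roads K))" by (rule P.pair_sym_arcs)
  then have sc: "strongly_connected (with_proj (roads K))"
    using K D.symmetric_connected_imp_strongly_connected unfolding is_network_def by blast
  have "W \<subseteq> pverts (roads K)" using W by (auto simp: customers_def)
  moreover have "finite W" using calculation P.pair_finite_verts by (rule finite_subset)
  ultimately obtain p where p: "is_tour K p"
    "W \<subseteq> set (pre_digraph.awalk_verts (with_proj (roads K)) (depot K) p)"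
    using D.closed_walk_through[OF sc, of "depot K" W] is_networkD(4)[OF K]
    unfolding is_tour_def by auto
  have "(replicate m p, replicate n p) \<in> covering K m n W"
    using p \<open>m + n \<ge> 1\<close> by (auto simp: covering_def families_def visited_def)
  moreover have "m \<ge> 1 \<longrightarrow> W \<subseteq> visited K (replicate m p)"
    using p by (auto simp: visited_def)
  ultimately show ?thesis by force
qed

lemma ex_optimal_family:
  assumes "is_network K" and "m + n \<ge> 1" and "W \<subseteq> customers K"
  shows "\<exists>F. is_arg_min (makespan K) (\<lambda>F. F \<in> covering K m n W) F"
  using ex_covering[OF assms] min_makespan_attained[OF assms(1,2), of "covering K m n W"]
  by (auto simp: covering_def)

lemma ex_OPT_family:
  assumes "is_rdp I"
  defines "K \<equiv> net I"
  shows "\<exists>F. is_arg_min (makespan K) (\<lambda>F. F \<in> {F \<in> covering K (trucks K) (drones K) (customers K).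
    damaged I \<subseteq> visited K (fst F)}) F"
proof -
  have K: "is_network K" and D: "damaged I \<subseteq> customers K" using assms by (auto simp: is_rdp_def)
  have t: "trucks K \<ge> 1" using K by (simp add: is_network_def)
  then have mn: "trucks K + drones K \<ge> 1" by simp
  show ?thesis
    using ex_covering[OF K mn order_refl] t D
    by (intro min_makespan_attained[OF K mn]) (force simp: covering_def)+
qed

lemma ex_selection_rule: "\<exists>S. selection_rule S"
proof
  show "selection_rule (\<lambda>K m n W. SOME F. is_arg_min (makespan K) (\<lambda>F. F \<in> covering K m n W) F)"
    unfolding selection_rule_def using someI_ex[OF ex_optimal_family] by blast
qed

lemma Optimistic_eq:
  assumes S: "selection_rule S" and I: "is_rdp I"
  shows "Optimistic S I = TSP (net I) (trucks (net I)) (drones (net I)) (customers (net I))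
    + TSP (net I) (trucks (net I)) 0 (undelivered S I)"
proof -
  have "is_network (net I)" "trucks (net I) \<ge> 1" "undelivered S I \<subseteq> customers (net I)"
    using I by (auto simp: is_rdp_def is_network_def undelivered_def)
  then show ?thesis
    using S min_makespan_eq unfolding selection_rule_def Optimistic_def TSP_def
      first_stage_def second_stage_def
    by (metis add.right_neutral order_refl trans_le_add1)
qed

end

theory Submission
  imports Defs
begin

text \<open>
  The network is a star whose leaves all lie at distance \<open>1\<close> from the depot, so serving \<open>j\<close> leaves
  takes a truck \<open>2 * j\<close> and a drone \<open>2 * j / \<alpha>\<close>. With \<open>f = \<lfloor>1 / \<alpha>\<rfloor>\<close> there are \<open>k_t * f + k_d\<close> leaves.
  Within time less than \<open>2 / \<alpha>\<close> no drone serves a leaf, and within time \<open>2 / \<alpha>\<close> a truck serves at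
  most \<open>f\<close> leaves and a drone at most one. Hence the first stage takes exactly \<open>2 / \<alpha>\<close> and leaves
  exactly \<open>k_d\<close> leaves to the drones. These become the damaged ones: the leaves being
  interchangeable, the full-information optimum is \<open>2 / \<alpha>\<close> as well, while the second stage takes
  \<open>2 * \<lceil>k_d / k_t\<rceil>\<close>.
\<close>

section \<open>The star network and its metric\<close>

definition star_roads :: "nat \<Rightarrow> nat pair_pre_digraph" where
  "star_roads m = \<lparr>pverts = {..m}, parcs = {0} \<times> {1..m} \<union> {1..m} \<times> {0}\<rparr>"

text \<open>The metric closure of the star: \<open>is_network\<close> demands the shortest-path
  distance on non-adjacent pairs too, which is 0 on the diagonal and 2, through the depot, between
  distinct leaves.\<close>

definition star_len :: "nat \<times> nat \<Rightarrow> real" where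
  "star_len e = (if fst e = snd e then 0 else if fst e = 0 \<or> snd e = 0 then 1 else 2)"

definition star :: "nat \<Rightarrow> nat \<Rightarrow> real \<Rightarrow> nat \<Rightarrow> nat network" where
  "star kt kd a m = \<lparr>trucks = kt, drones = kd, speed = a, roads = star_roads m,
     depot = 0, len = star_len\<rparr>"

lemma star_simps [simp]:
  "trucks (star kt kd a m) = kt" "drones (star kt kd a m) = kd" "speed (star kt kd a m) = a"
  "roads (star kt kd a m) = star_roads m" "depot (star kt kd a m) = 0"
  "len (star kt kd a m) = star_len" "customers (star kt kd a m) = {1..m}"
  "pverts (star_roads m) = {..m}" "parcs (star_roads m) = {0} \<times> {1..m} \<union> {1..m} \<times> {0}"
  by (auto simp: star_def customers_def star_roads_def)

lemma star_pair_graph: "pair_graph (star_roads m)"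
  by unfold_locales (auto simp: symmetric_def intro!: symI)

lemma star_len_triangle: "star_len (u, w) \<le> star_len (u, v) + star_len (v, w)"
  by (auto simp: star_len_def)

text \<open>The triangle inequality telescopes along the walk. This is the lower bound for the
  shortest-path condition in \<open>is_network\<close>.\<close>

lemma star_len_le_cost:
  assumes "pcas u p v"
  shows "star_len (u, v) \<le> sum_list (map star_len p)"
  using assms
proof (induction p arbitrary: u)
  case Nil
  then show ?case by (simp add: star_len_def)
next
  case (Cons e p)
  then have "star_len (snd e, v) \<le> sum_list (map star_len p)" "fst e = u" by auto
  then show ?case using star_len_triangle[of u v "snd e"] by (cases e) auto
qed

lemma star_network:
  assumes "kt \<ge> 1" "kd \<ge> 1" "a > 0" "m \<ge> 1"
  shows "is_network (star kt kd a m)"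
proof -
  interpret P: pair_graph "star_roads m" by (rule star_pair_graph)
  let ?G = "with_proj (star_roads m)"
  have walk: "P.awalk u p v \<longleftrightarrow> u \<le> m \<and> set p \<subseteq> parcs (star_roads m) \<and> pcas u p v" for u p v
    by (simp add: P.awalk_def)
  \<comment> \<open>The walk is empty, a single arc, or a detour through the depot. It yields both
    the upper bound on the distance and the reachability behind connectedness.\<close>
  have ex_walk: "\<exists>p. P.awalk u p v \<and> sum_list (map star_len p) \<le> star_len (u, v)"
    if "u \<le> m" "v \<le> m" for u v
  proof (cases "u = v \<or> u = 0 \<or> v = 0")
    case True
    then show ?thesis using that
      by (intro exI[of _ "if u = v then [] else [(u, v)]"]) (auto simp: walk star_len_def)
  next
    case False
    then show ?thesis using that
      by (intro exI[of _ "[(u, 0), (0, v)]"]) (auto simp: walk star_len_def)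
  qed
  have mu: "ereal (star_len (u, v)) = P.\<mu> star_len u v"
    if "u \<le> m" "v \<le> m" for u v
  proof (rule antisym)
    show "ereal (star_len (u, v)) \<le> P.\<mu> star_len u v"
      unfolding P.\<mu>_def P.awalk_cost_def
      by (intro INF_greatest) (auto simp: walk intro: star_len_le_cost)
    show "P.\<mu> star_len u v \<le> ereal (star_len (u, v))"
      using ex_walk[OF that] P.min_cost_le_walk_cost[of u _ v star_len]
      unfolding P.awalk_cost_def by (meson ereal_less_eq(3) order_trans)
  qed
  have "u \<rightarrow>\<^sup>*\<^bsub>?G\<^esub> v" if "u \<le> m" "v \<le> m" for u v
    using ex_walk[OF that] P.reachable_awalk by blast
  then have "Digraph_Component.connected ?G"
    using P.reachable_mk_symmetricI
    by (auto simp: connected_def strongly_connected_def mk_symmetric_def)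
  moreover have "star_len (u, v) = star_len (v, u)" for u v by (auto simp: star_len_def)
  moreover have "star_len e > 0" if "e \<in> parcs (star_roads m)" for e
    using that by (auto simp: star_len_def)
  ultimately show ?thesis
    using assms mu star_pair_graph unfolding is_network_def star_simps
    by (intro conjI ballI impI star_len_triangle) auto
qed

section \<open>Tour length against the number of leaves visited\<close>

lemma is_tour_star:
  "is_tour (star kt kd a m) p \<longleftrightarrow> set p \<subseteq> {0} \<times> {1..m} \<union> {1..m} \<times> {0} \<and> pcas 0 p 0"
  by (simp add: is_tour_def pre_digraph.awalk_def cas_with_proj_eq)

lemma visited_star: "visited (star kt kd a m) ps = (\<Union>p \<in> set ps. set (pawalk_verts 0 p))"
  by (simp add: visited_def awalk_verts_with_proj_eq)

text \<open>Applied to a closed walk at the depot: every leaf on it is both entered and left by some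
  arc of the walk.\<close>

lemma pcas_endpoints:
  assumes "pcas u p w" "v \<in> set (pawalk_verts u p)"
  shows "(v = u \<or> v \<in> snd ` set p) \<and> (v = w \<or> v \<in> fst ` set p)"
  using assms by (induction p arbitrary: u) auto

text \<open>The only neighbour of a leaf is the depot, so a visited leaf forces both of its arcs
  onto the tour. These arcs are pairwise distinct because 0 is not a leaf.\<close>

lemma star_tour_length:
  assumes "is_tour (star kt kd a m) p"
  shows "2 * card (set (pawalk_verts 0 p) \<inter> {1..m}) \<le> length p"
proof -
  define A where "A = set (pawalk_verts 0 p) \<inter> {1..m}"
  have arcs: "set p \<subseteq> {0} \<times> {1..m} \<union> {1..m} \<times> {0}" and "pcas 0 p 0"
    using assms by (auto simp: is_tour_star)
  have "Pair 0 ` A \<union> (\<lambda>v. (v, 0)) ` A \<subseteq> set p"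
  proof -
    have "(0, v) \<in> set p \<and> (v, 0) \<in> set p" if "v \<in> A" for v
    proof -
      have "v \<in> snd ` set p" "v \<in> fst ` set p"
        using pcas_endpoints[OF \<open>pcas 0 p 0\<close>, of v] that by (auto simp: A_def)
      then show ?thesis using arcs that by (force simp: A_def)
    qed
    then show ?thesis by auto
  qed
  then have "card (Pair 0 ` A \<union> (\<lambda>v. (v, 0)) ` A) \<le> card (set p)"
    by (intro card_mono) auto
  moreover have "card (Pair 0 ` A \<union> (\<lambda>v. (v, 0)) ` A) = card A + card A"
    by (subst card_Un_disjoint) (auto simp: A_def card_image inj_on_def)
  ultimately show ?thesis using card_length[of p] by (simp add: A_def)
qed

lemma star_truck_time:
  assumes "is_network (star kt kd a m)" "is_tour (star kt kd a m) p"
  shows "truck_time (star kt kd a m) p = length p"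
proof -
  have "map star_len p = map (\<lambda>_. 1) p"
    using assms(2) by (intro map_cong) (auto simp: is_tour_star star_len_def)
  then show ?thesis
    by (simp only: truck_time_sum[OF assms(1)] star_simps sum_list_triv mult_1_right)
qed

section \<open>Sharing out leaves among several tours\<close>

lemma star_leaves_tour:
  assumes "set vs \<subseteq> {1..m}"
  obtains p where "is_tour (star kt kd a m) p" "set vs \<subseteq> set (pawalk_verts 0 p)"
    "length p = 2 * length vs"
proof
  define p where "p = concat (map (\<lambda>v. [(0, v), (v, 0)]) vs)"
  show "is_tour (star kt kd a m) p"
    using assms unfolding p_def by (induction vs) (auto simp: is_tour_star)
  show "set vs \<subseteq> set (pawalk_verts 0 p)" "length p = 2 * length vs"
    unfolding p_def by (induction vs) auto
qed

text \<open>An enumeration of \<open>A\<close> is cut off \<open>n\<close> entries at a time, one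
  list per vehicle. Empty lists are allowed, so the number of lists is exactly
  \<open>k\<close>.\<close>

lemma finite_as_short_lists:
  assumes "finite A" "card A \<le> k * n"
  shows "\<exists>L. length L = k \<and> (\<forall>xs \<in> set L. length xs \<le> n) \<and> \<Union> (set ` set L) = A"
  using assms
proof (induction k arbitrary: A)
  case 0
  then show ?case by simp
next
  case (Suc k)
  obtain xs where xs: "set xs = A" "distinct xs" using finite_distinct_list[OF Suc.prems(1)] by blast
  have "card (set (drop n xs)) \<le> k * n"
    using Suc.prems(2) xs distinct_card[of xs] distinct_card[of "drop n xs"] by auto
  then obtain L where L: "length L = k" "\<forall>xs \<in> set L. length xs \<le> n"
    "\<Union> (set ` set L) = set (drop n xs)"
    using Suc.IH[of "set (drop n xs)"] by blast
  have "set (take n xs) \<union> set (drop n xs) = A"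
    using xs(1) by (metis append_take_drop_id set_append)
  then show ?case using L by (intro exI[of _ "take n xs # L"]) auto
qed

lemma star_tours:
  assumes "A \<subseteq> {1..m}" "card A \<le> k * n"
  obtains ps where "length ps = k" "A \<subseteq> visited (star kt kd a m) ps"
    "\<And>p. p \<in> set ps \<Longrightarrow> is_tour (star kt kd a m) p \<and> length p \<le> 2 * n"
proof -
  have "finite A" using assms(1) by (rule finite_subset) simp
  then obtain L where L: "length L = k" "\<forall>vs \<in> set L. length vs \<le> n" "\<Union> (set ` set L) = A"
    using finite_as_short_lists[OF _ assms(2)] by blast
  have "\<exists>p. is_tour (star kt kd a m) p \<and> set vs \<subseteq> set (pawalk_verts 0 p) \<and> length p = 2 * length vs"
    if "vs \<in> set L" for vs
    using star_leaves_tour[of vs m kt kd a] that L(3) assms(1) by (metis UN_upper order_trans)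
  then obtain t where t: "\<And>vs. vs \<in> set L \<Longrightarrow> is_tour (star kt kd a m) (t vs) \<and>
      set vs \<subseteq> set (pawalk_verts 0 (t vs)) \<and> length (t vs) = 2 * length vs"
    by metis
  show thesis
  proof (rule that[of "map t L"])
    show "A \<subseteq> visited (star kt kd a m) (map t L)"
      using t L(3) by (fastforce simp: visited_star)
  qed (use t L in auto)
qed

text \<open>The converse of \<open>star_tours\<close>, by \<open>star_tour_length\<close> and a
  union bound. The strict bound at \<open>Suc n\<close> leaves saves rounding time limits such as
  \<open>2 / \<alpha>\<close> down to even integers.\<close>

lemma star_capacity:
  assumes "\<And>p. p \<in> set ps \<Longrightarrow> is_tour (star kt kd a m) p \<and> length p < 2 * Suc n"
  shows "card (visited (star kt kd a m) ps \<inter> {1..m}) \<le> length ps * n"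
proof -
  have "visited (star kt kd a m) ps \<inter> {1..m} = (\<Union>p \<in> set ps. set (pawalk_verts 0 p) \<inter> {1..m})"
    by (auto simp: visited_star)
  also have "card \<dots> \<le> (\<Sum>p \<in> set ps. card (set (pawalk_verts 0 p) \<inter> {1..m}))"
    by (rule card_UN_le) simp
  also have "\<dots> \<le> (\<Sum>p \<in> set ps. n)"
  proof (rule sum_mono)
    fix p assume "p \<in> set ps"
    then show "card (set (pawalk_verts 0 p) \<inter> {1..m}) \<le> n"
      using assms[of p] star_tour_length[of kt kd a m p] by auto
  qed
  also have "\<dots> \<le> length ps * n" using card_length[of ps] by simp
  finally show ?thesis .
qed

section \<open>Makespan bounds for families on the star\<close>

lemma star_makespan_le_iff:
  assumes K: "is_network (star kt kd a m)" and F: "F \<in> families (star kt kd a m) i j" "i + j \<ge> 1"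
  shows "makespan (star kt kd a m) F \<le> B \<longleftrightarrow>
    (\<forall>p \<in> set (fst F). real (length p) \<le> B) \<and> (\<forall>p \<in> set (snd F). real (length p) \<le> B * a)"
proof -
  have "a > 0" using K by (simp add: is_network_def)
  then show ?thesis
    using F star_truck_time[OF K] unfolding makespan_le_iff[OF F]
    by (auto simp: families_def drone_time_eq[OF K] field_simps)
qed

text \<open>\<open>x\<close> and \<open>y\<close> are capacities of one truck and one drone within
  time \<open>B\<close>. Trucks and drones are counted separately because both bounds are needed to
  find exactly how many leaves the first stage leaves to drones.\<close>

lemma card_visited_le:
  assumes K: "is_network (star kt kd a m)" and F: "F \<in> covering (star kt kd a m) i j W"
    and "i + j \<ge> 1" and le: "makespan (star kt kd a m) F \<le> B"
    and b: "B < 2 * Suc x" "B * a < 2 * Suc y"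
  shows "card (visited (star kt kd a m) (fst F) \<inter> {1..m}) \<le> i * x"
    and "card (visited (star kt kd a m) (snd F) \<inter> {1..m}) \<le> j * y"
proof -
  have fam: "F \<in> families (star kt kd a m) i j" using F by (simp add: covering_def)
  have t: "\<And>p. p \<in> set (fst F) \<Longrightarrow> real (length p) \<le> B"
    and d: "\<And>p. p \<in> set (snd F) \<Longrightarrow> real (length p) \<le> B * a"
    using le star_makespan_le_iff[OF K fam \<open>i + j \<ge> 1\<close>] by auto
  have "is_tour (star kt kd a m) p \<and> length p < 2 * Suc x" if "p \<in> set (fst F)" for p
  proof -
    have "real (length p) < real (2 * Suc x)" using t[OF that] b(1) by simp
    then show ?thesis using that fam by (auto simp: families_def simp del: of_nat_mult)
  qed
  moreover have "is_tour (star kt kd a m) p \<and> length p < 2 * Suc y" if "p \<in> set (snd F)" for p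
  proof -
    have "real (length p) < real (2 * Suc y)" using d[OF that] b(2) by simp
    then show ?thesis using that fam by (auto simp: families_def simp del: of_nat_mult)
  qed
  moreover have "length (fst F) = i" "length (snd F) = j" using fam by (auto simp: families_def)
  ultimately show "card (visited (star kt kd a m) (fst F) \<inter> {1..m}) \<le> i * x"
    "card (visited (star kt kd a m) (snd F) \<inter> {1..m}) \<le> j * y"
    using star_capacity by metis+
qed

text \<open>Serves as a lower bound on makespans: with \<open>B\<close> the makespan itself, a
  family that is too fast covers too few leaves.\<close>

lemma card_covered_le:
  assumes K: "is_network (star kt kd a m)" and W: "W \<subseteq> {1..m}"
    and F: "F \<in> covering (star kt kd a m) i j W"
    and "i + j \<ge> 1" and le: "makespan (star kt kd a m) F \<le> B"
    and b: "B < 2 * Suc x" "B * a < 2 * Suc y"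
  shows "card W \<le> i * x + j * y"
proof -
  let ?V = "\<lambda>ps. visited (star kt kd a m) ps \<inter> {1..m}"
  have "W \<subseteq> ?V (fst F) \<union> ?V (snd F)"
    using F W by (auto simp: covering_def visited_def)
  then have "card W \<le> card (?V (fst F) \<union> ?V (snd F))" by (intro card_mono) auto
  also have "\<dots> \<le> card (?V (fst F)) + card (?V (snd F))" by (rule card_Un_le)
  also have "\<dots> \<le> i * x + j * y"
    using card_visited_le[OF K F \<open>i + j \<ge> 1\<close> le b] by (intro add_mono)
  finally show ?thesis .
qed

lemma star_family:
  assumes K: "is_network (star kt kd a m)" and "i + j \<ge> 1"
    and A: "A \<subseteq> {1..m}" "card A \<le> i * x" and A': "A' \<subseteq> {1..m}" "card A' \<le> j * y"
    and b: "2 * real x \<le> B" "2 * real y \<le> B * a"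
  shows "\<exists>F \<in> covering (star kt kd a m) i j (A \<union> A').
    A \<subseteq> visited (star kt kd a m) (fst F) \<and> makespan (star kt kd a m) F \<le> B"
proof -
  obtain ts where ts: "length ts = i" "A \<subseteq> visited (star kt kd a m) ts"
    "\<And>p. p \<in> set ts \<Longrightarrow> is_tour (star kt kd a m) p \<and> length p \<le> 2 * x"
    using star_tours[OF A] by metis
  obtain ds where ds: "length ds = j" "A' \<subseteq> visited (star kt kd a m) ds"
    "\<And>p. p \<in> set ds \<Longrightarrow> is_tour (star kt kd a m) p \<and> length p \<le> 2 * y"
    using star_tours[OF A'] by metis
  have F: "(ts, ds) \<in> covering (star kt kd a m) i j (A \<union> A')"
    using ts ds by (auto simp: covering_def families_def visited_def)
  then have fam: "(ts, ds) \<in> families (star kt kd a m) i j" by (simp add: covering_def)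
  have "real (length p) \<le> B" if "p \<in> set ts" for p
    using ts(3)[OF that] b(1) by (simp flip: of_nat_le_iff[where 'a = real])
  moreover have "real (length p) \<le> B * a" if "p \<in> set ds" for p
    using ds(3)[OF that] b(2) by (simp flip: of_nat_le_iff[where 'a = real])
  ultimately have "makespan (star kt kd a m) (ts, ds) \<le> B"
    using star_makespan_le_iff[OF K fam \<open>i + j \<ge> 1\<close>] by auto
  then show ?thesis using F ts(2) by force
qed

lemma min_makespan_eqI:
  assumes "F \<in> \<F>" "makespan K F \<le> B" "\<And>F'. F' \<in> \<F> \<Longrightarrow> B \<le> makespan K F'"
  shows "min_makespan K \<F> = B"
proof -
  have "makespan K F = B" using assms by (intro antisym)
  then show ?thesis
    using min_makespan_eq[of K \<F> F] assms by (auto simp: is_arg_min_linorder)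
qed

theorem lemma20:
  fixes \<alpha> :: real and k_t k_d :: nat and S :: "nat rule"
  assumes "\<alpha> > 0" and "k_t \<ge> 1" and "k_d \<ge> 1"
    and "\<alpha> * of_int \<lceil>real k_d / real k_t\<rceil> < 1"
    and "selection_rule S"
  shows "\<exists>I :: nat rdp. is_rdp I \<and>
    trucks (net I) = k_t \<and> drones (net I) = k_d \<and> speed (net I) = \<alpha> \<and>
    Optimistic S I / OPT I = 1 + of_int \<lceil>real k_d / real k_t\<rceil> * \<alpha>"
proof -
  define q where "q = nat \<lceil>real k_d / real k_t\<rceil>"
  define f where "f = nat \<lfloor>1 / \<alpha>\<rfloor>"
  define m where "m = k_t * f + k_d"
  define K where "K = star k_t k_d \<alpha> m"
  have "real k_d / real k_t > 0" using assms by simp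
  then have ceil: "\<lceil>real k_d / real k_t\<rceil> = int q" and "q \<ge> 1"
    unfolding q_def by linarith+
  have "real k_d / real k_t \<le> q" "real q - 1 < real k_d / real k_t"
    using ceil by linarith+
  then have "real k_d \<le> real (k_t * q)" "real (k_t * (q - 1)) < real k_d"
    using assms(2) \<open>q \<ge> 1\<close> by (simp_all add: field_simps of_nat_diff)
  \<comment> \<open>So \<open>q\<close> is the least load per truck with which \<open>k_t\<close>
    trucks can serve \<open>k_d\<close> leaves; the two halves give the two bounds on the second
    stage.\<close>
  then have kd_le: "k_d \<le> k_t * q" and kd_gt: "k_t * (q - 1) < k_d"
    by (simp_all only: of_nat_le_iff of_nat_less_iff)
  \<comment> \<open>The hypothesis on \<alpha> enters here. With \<open>kd_le\<close>,
    \<open>q \<le> f\<close> lets the trucks alone serve any \<open>k_d\<close> leaves within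
    \<open>2 / \<alpha>\<close>.\<close>
  have "real q \<le> 1 / \<alpha>" using assms(1,4) ceil by (simp add: field_simps)
  then have "q \<le> f" unfolding f_def by linarith
  have f: "real f \<le> 1 / \<alpha>" "1 / \<alpha> < Suc f"
    using assms(1) unfolding f_def by (simp, linarith)
  have net: "is_network K" unfolding K_def using assms by (intro star_network) (auto simp: m_def)
  have kk: "k_t + k_d \<ge> 1" "k_t + 0 \<ge> 1" using assms by auto
  let ?B = "2 / \<alpha>"
  have B: "?B * \<alpha> = 2" using assms(1) by simp
  have B_less: "?B < 2 * Suc f" using mult_strict_left_mono[OF f(2), of 2] by simp
  have full_ge: "?B \<le> makespan K F" if F: "F \<in> covering K k_t k_d {1..m}" for F
  proof (rule ccontr)
    assume less: "\<not> ?B \<le> makespan K F"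
    then have lt: "makespan K F < 2 * Suc f" using B_less by linarith
    have "makespan K F * \<alpha> < ?B * \<alpha>"
      using less by (intro mult_strict_right_mono assms(1)) simp
    \<comment> \<open>Drone capacity 0: the trucks alone cover at most \<open>k_t * f\<close>
      leaves, which is \<open>k_d\<close> short of \<open>m\<close>.\<close>
    then have "makespan K F * \<alpha> < 2 * Suc 0" unfolding B by simp
    from card_covered_le[OF net[unfolded K_def] order_refl F[unfolded K_def] kk(1) order_refl
        lt[unfolded K_def] this[unfolded K_def]]
    show False using assms(3) by (simp add: m_def)
  qed
  have full: "\<exists>F \<in> covering K k_t k_d {1..m}. A \<subseteq> visited K (fst F) \<and> makespan K F \<le> ?B"
    if A: "A \<subseteq> {1..m}" "card A \<le> k_t * f" for A
  proof -
    have fin: "finite A" using A(1) by (rule finite_subset) simp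
    \<comment> \<open>\<open>A\<close> is padded to exactly \<open>k_t * f\<close> leaves for the
      trucks, so that \<open>k_d\<close> leaves remain, one per drone.\<close>
    have "k_t * f - card A \<le> card ({1..m} - A)"
      unfolding card_Diff_subset[OF fin A(1)] by (simp add: m_def)
    then obtain A' where A': "A' \<subseteq> {1..m} - A" "card A' = k_t * f - card A"
      by (rule obtain_subset_with_card_n)
    have fin': "finite A'" using A'(1) by (rule finite_subset) simp
    have "A \<inter> A' = {}" using A'(1) by blast
    then have card: "card (A \<union> A') = k_t * f"
      using A(2) A'(2) by (simp add: card_Un_disjoint[OF fin fin'])
    have sub: "A \<union> A' \<subseteq> {1..m}" using A(1) A'(1) by blast
    have "card ({1..m} - (A \<union> A')) = k_d"
      using card_Diff_subset[OF finite_UnI[OF fin fin'] sub] card by (simp add: m_def)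
    then have "card ({1..m} - (A \<union> A')) \<le> k_d * 1" by simp
    moreover have "2 * real f \<le> ?B" using mult_left_mono[OF f(1), of 2] by simp
    moreover have "2 * real 1 \<le> ?B * \<alpha>" unfolding B by simp
    ultimately have "\<exists>F \<in> covering K k_t k_d ((A \<union> A') \<union> ({1..m} - (A \<union> A'))).
        A \<union> A' \<subseteq> visited K (fst F) \<and> makespan K F \<le> ?B"
      unfolding K_def
      by (intro star_family[OF net[unfolded K_def] kk(1) sub eq_imp_le[OF card] Diff_subset])
    moreover have "(A \<union> A') \<union> ({1..m} - (A \<union> A')) = {1..m}" using sub by blast
    ultimately show ?thesis by (simp only: Un_subset_iff) blast
  qed
  \<comment> \<open>The rule sees only \<open>K\<close> and the leaf set, so \<open>F1\<close> is
    fixed before the damaged set is chosen and \<open>D\<close> may depend on it.\<close>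
  define F1 where "F1 = S K k_t k_d {1..m}"
  have "{1..m} \<subseteq> customers K" by (simp add: K_def)
  then have "is_arg_min (makespan K) (\<lambda>F. F \<in> covering K k_t k_d {1..m}) F1"
    using assms(5) net kk(1) unfolding selection_rule_def F1_def by blast
  then have F1: "F1 \<in> covering K k_t k_d {1..m}"
    and F1_min: "\<And>F. F \<in> covering K k_t k_d {1..m} \<Longrightarrow> makespan K F1 \<le> makespan K F"
    unfolding is_arg_min_linorder by blast+
  obtain F0 where "F0 \<in> covering K k_t k_d {1..m}" "makespan K F0 \<le> ?B"
    using full[of "{}"] by auto
  then have F1_le: "makespan K F1 \<le> ?B" using F1_min order_trans by blast
  define D where "D = {1..m} - visited K (fst F1)"
  \<comment> \<open>At the time limit \<open>?B\<close> itself the drone capacity is 1. The truck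
    and drone capacities then add up to exactly \<open>m\<close>, so both bounds are tight and
    \<open>card D = k_d\<close>.\<close>
  have "?B * \<alpha> < 2 * Suc 1" unfolding B by simp
  note vis = card_visited_le[OF net[unfolded K_def] F1[unfolded K_def] kk(1)
      F1_le[unfolded K_def] B_less this, folded K_def]
  have "D \<subseteq> visited K (snd F1) \<inter> {1..m}" using F1 by (auto simp: D_def covering_def visited_def)
  then have "card D \<le> k_d" using card_mono[of "visited K (snd F1) \<inter> {1..m}" D] vis(2) by simp
  moreover have "card D = m - card (visited K (fst F1) \<inter> {1..m})"
    unfolding D_def by (subst card_Diff_subset_Int) (auto simp: Int_commute)
  ultimately have card_D: "card D = k_d" using vis(1) by (simp add: m_def)
  have D: "D \<subseteq> {1..m}" by (auto simp: D_def)
  define I where "I = \<lparr>net = K, damaged = D\<rparr>"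
  have simps: "net I = K" "damaged I = D" "customers K = {1..m}" "trucks K = k_t" "drones K = k_d"
    by (simp_all add: I_def K_def)
  have rdp: "is_rdp I" using net D by (simp add: is_rdp_def simps)
  have "card D \<le> k_t * f" using card_D kd_le \<open>q \<le> f\<close> by (meson mult_le_mono2 order_trans)
  from full[OF D this] obtain F2 where F2: "F2 \<in> covering K k_t k_d {1..m}"
    "D \<subseteq> visited K (fst F2)" "makespan K F2 \<le> ?B" by blast
  have OPT: "OPT I = ?B"
    unfolding OPT_def simps using F2 full_ge by (intro min_makespan_eqI[of F2]) simp_all
  have first: "TSP K k_t k_d {1..m} = ?B"
    unfolding TSP_def using F1 F1_le full_ge by (rule min_makespan_eqI)
  have second: "TSP K k_t 0 D = 2 * q"
  proof -
    have "\<exists>F \<in> covering K k_t 0 (D \<union> {}). D \<subseteq> visited K (fst F) \<and> makespan K F \<le> 2 * q"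
      unfolding K_def using card_D kd_le assms(1)
      by (intro star_family[where x = q and y = 0] net[unfolded K_def] kk D) simp_all
    then obtain F where "F \<in> covering K k_t 0 D" "makespan K F \<le> 2 * q" by auto
    moreover have "2 * q \<le> makespan K F" if F: "F \<in> covering K k_t 0 D" for F
    proof (rule ccontr)
      assume less: "\<not> 2 * q \<le> makespan K F"
      \<comment> \<open>Any drone capacity \<open>y\<close> will do, as it is multiplied by 0
        drones. Truck capacity \<open>q - 1\<close> contradicts \<open>kd_gt\<close>.\<close>
      obtain y :: nat where y: "makespan K F * \<alpha> < y" using reals_Archimedean2 by blast
      have "makespan K F < 2 * Suc (q - 1)" "makespan K F * \<alpha> < 2 * Suc y"
        using less \<open>q \<ge> 1\<close> y by simp_all
      from card_covered_le[OF net[unfolded K_def] D F[unfolded K_def] kk(2) order_refl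
          this[unfolded K_def]]
      show False using card_D kd_gt by simp
    qed
    ultimately show ?thesis unfolding TSP_def by (rule min_makespan_eqI)
  qed
  have "undelivered S I = D"
    by (auto simp: undelivered_def first_stage_def simps D_def F1_def)
  then have "Optimistic S I = ?B + 2 * q"
    using Optimistic_eq[OF assms(5) rdp] first second by (simp add: simps)
  then have "Optimistic S I / OPT I = 1 + of_int \<lceil>real k_d / real k_t\<rceil> * \<alpha>"
    unfolding OPT ceil using assms(1) by (simp add: field_simps)
  then show ?thesis using rdp by (intro exI[of _ I]) (simp add: simps K_def)
qed

end
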